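(* Let $n \ge 1$ and let $\{G_1, G_2, \ldots, G_n\}$ be a finite collection of (finite, simple, connected) graphs, where each $G_i$ has a fixed terminal vertex $v_{0_i}$, $i=1,2,\ldots,n$. Let $G = \mathrm{Vertex\text{-}Amal}\{G_i; v_{0_i}\}$ be the vertex-amalgamation of $G_1, \ldots, G_n$. Then \[\sum_{i=1}^{n} \dim(G_i) - n \;\leq\; \dim(G) \;\leq\; \sum_{i=1}^{n} \dim(G_i) + n - 1.\] Moreover, the bounds are sharp, and there are infinitely many such vertex-amalgamations whose metric dimension equals each of the values within the range of the bounds.
   Context: All graphs are finite, simple and connected. The distance $d(u,v)$ between vertices $u,v$ of a connected graph is the length of a shortest $u$–$v$ path. For an ordered set $W=\{w_1,\ldots,w_k\}\subseteq V(G)$, the representation of a vertex $v$ with respect to $W$ is $r(v\mid W)=(d(v,w_1),\ldots,d(v,w_k))$. $W$ is a resolving set of $G$ if $r(u\mid W)=r(v\mid W)$ implies $u=v$ for all $u,v\in V(G)$. The metric dimension $\dim(G)$ is the minimum cardinality of a resolving set of $G$. Given graphs $G_1,\ldots,G_n$, each with a fixed vertex $v_{0_i}$ (terminal vertex), the vertex-amalgamation $\mathrm{Vertex\text{-}Amal}\{G_i;v_{0_i}\}$ is the graph obtained by taking the disjoint union of the $G_i$ and identifying all terminal vertices $v_{0_1},\ldots,v_{0_n}$ into a single vertex.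
   Formalization: Sharpness of the lower bound, and attaining that value infinitely often, is claimed only for n ≥ 2: for n = 1 the amalgamation is G_1 itself, so dim(G) = dim(G_1) and the value dim(G_1) − 1 never occurs. *)

theory Defs
  imports "Graph_Theory.Graph_Theory"
begin

text \<open>
  A finite simple graph is a \<^locale>\<open>pair_graph\<close>: each undirected edge is represented by its two
  opposite arcs.
\<close>

text \<open>Meaningful only when \<open>v\<close> is reachable from \<open>u\<close>.\<close>

definition graph_dist :: "'a pair_pre_digraph \<Rightarrow> 'a \<Rightarrow> 'a \<Rightarrow> nat" where
  "graph_dist G u v = (LEAST l. \<exists>p. pre_digraph.apath (with_proj G) u p v \<and> length p = l)"

definition representation :: "'a pair_pre_digraph \<Rightarrow> 'a list \<Rightarrow> 'a \<Rightarrow> nat list" where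
  "representation G W v = map (graph_dist G v) W"

text \<open>An ordered set of vertices is a list without repetitions; it may be empty.\<close>

definition resolving_set :: "'a pair_pre_digraph \<Rightarrow> 'a list \<Rightarrow> bool" where
  "resolving_set G W \<longleftrightarrow> distinct W \<and> set W \<subseteq> pverts G \<and>
     (\<forall>u \<in> pverts G. \<forall>v \<in> pverts G. representation G W u = representation G W v \<longrightarrow> u = v)"

definition metric_dim :: "'a pair_pre_digraph \<Rightarrow> nat" where
  "metric_dim G = (LEAST k. \<exists>W. resolving_set G W \<and> length W = k)"

definition rooted_graphs :: "nat \<Rightarrow> (nat \<Rightarrow> 'a pair_pre_digraph) \<Rightarrow> (nat \<Rightarrow> 'a) \<Rightarrow> bool" where
  "rooted_graphs n G t \<longleftrightarrow>
     (\<forall>i \<in> {1..n}. pair_graph (G i) \<and> connected (with_proj (G i)) \<and> t i \<in> pverts (G i))"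

text \<open>
  The quotient map from the disjoint union: \<open>None\<close> is the vertex obtained by identifying all the
  terminal vertices, and \<open>Some (i, v)\<close> is the copy of a non-terminal vertex \<open>v\<close> of the \<open>i\<close>-th graph.
\<close>

definition amal_vertex :: "(nat \<Rightarrow> 'a) \<Rightarrow> nat \<Rightarrow> 'a \<Rightarrow> (nat \<times> 'a) option" where
  "amal_vertex t i v = (if v = t i then None else Some (i, v))"

definition vertex_amal ::
    "nat \<Rightarrow> (nat \<Rightarrow> 'a pair_pre_digraph) \<Rightarrow> (nat \<Rightarrow> 'a) \<Rightarrow> (nat \<times> 'a) option pair_pre_digraph" where
  "vertex_amal n G t =
     \<lparr> pverts = (\<Union>i \<in> {1..n}. amal_vertex t i ` pverts (G i)),
       parcs = (\<Union>i \<in> {1..n}. map_prod (amal_vertex t i) (amal_vertex t i) ` parcs (G i)) \<rparr>"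

end

theory Submission
  imports Defs
begin

text \<open>
  Distances inside a component are unchanged by the amalgamation, and distances between different
  components add up through the common vertex. Hence the part of a resolving set of the
  amalgamation that lies in \<open>G\<^sub>i\<close>, together with the terminal vertex, resolves \<open>G\<^sub>i\<close>: this gives the
  lower bound. Conversely, a union of bases of the components can only fail to separate \<open>u\<close> in
  \<open>G\<^sub>i\<close> from \<open>v\<close> in \<open>G\<^sub>j\<close> if the terminal vertex lies on geodesics from \<open>u\<close> to the whole
  basis of \<open>G\<^sub>i\<close>, and likewise for \<open>v\<close>. Adding one suitable neighbour of the terminal vertex to a
  basis destroys all such vertices of its component, and it suffices to do this in all components
  but one: this gives the upper bound.

  For the values in between, amalgamate \<open>q\<close> stars at their centres, \<open>p\<close> complete graphs and
  some single edges. Apart from the common vertex, the result splits into classes of twins, namely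
  one class per complete graph and one class of all leaves, and a basis consists of all but one
  vertex of each class. So the dimension differs from the sum of the dimensions by \<open>q - p - 1\<close>,
  or by \<open>-n\<close> if all components are complete.
\<close>

section \<open>Distances\<close>

context pair_wf_digraph
begin

text \<open>Each step of loop erasure replaces \<open>q @ r @ s\<close> by \<open>q @ s\<close>, so
  the walk never gets longer. Hence walks can stand in for the simple paths in the definition of
  \<open>graph_dist\<close>.\<close>

lemma length_awalk_to_apath:
  assumes "awalk u p v"
  shows "length (awalk_to_apath p) \<le> length p"
  using assms
proof (induct rule: awalk_to_apath_induct)
  case (path p)
  then have "awalk_to_apath p = p"
    by (auto simp: awalk_to_apath.simps)
  then show ?case by simp
next
  case (decomp p q r s)
  then have "p = q @ r @ s"
    using awalk_cyc_decompE by metis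
  then show ?case
    using decomp step_awalk_to_apath[of u p v q r s] by simp
qed

lemma graph_dist_le:
  assumes "awalk u p v"
  shows "graph_dist G u v \<le> length p"
proof -
  have "graph_dist G u v \<le> length (awalk_to_apath p)"
    unfolding graph_dist_def by (rule Least_le) (use apath_awalk_to_apath[OF assms] in blast)
  then show ?thesis using length_awalk_to_apath[OF assms] by simp
qed

lemma shortest_awalk:
  assumes "awalk u q v"
  obtains p where "awalk u p v" "length p = graph_dist G u v"
proof -
  have "\<exists>p. apath u p v \<and> length p = graph_dist G u v"
    unfolding graph_dist_def by (rule LeastI_ex) (use apath_awalk_to_apath[OF assms] in blast)
  then show ?thesis using that by (auto simp: apath_def)
qed

section \<open>Certifying distances by potential functions\<close>

lemma awalk_of_descent:
  assumes "x \<in> pverts G"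
    and zero: "\<And>x. x \<in> pverts G \<Longrightarrow> f x = 0 \<Longrightarrow> x = v"
    and descent: "\<And>x. x \<in> pverts G \<Longrightarrow> f x \<noteq> 0 \<Longrightarrow> \<exists>y. (x, y) \<in> parcs G \<and> f x = Suc (f y)"
  shows "\<exists>p. awalk x p v \<and> length p = f x"
  using assms(1)
proof (induct "f x" arbitrary: x)
  case 0
  then show ?case using zero by (auto intro!: exI[of _ "[]"] simp: awalk_Nil_iff)
next
  case (Suc l)
  then obtain y where y: "(x, y) \<in> parcs G" "f x = Suc (f y)" using descent by force
  then obtain p where "awalk y p v" "length p = f y"
    using Suc in_arcsD2 by (metis nat.inject)
  then show ?case using y Suc(3)
    by (auto intro!: exI[of _ "(x, y) # p"] simp: awalk_Cons_iff)
qed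

lemma lipschitz_le_length_awalk:
  assumes "awalk x p v"
    and "\<And>x y. (x, y) \<in> parcs G \<Longrightarrow> f x \<le> Suc (f y)"
  shows "f x \<le> f v + length p"
  using assms(1)
proof (induct p arbitrary: x)
  case Nil
  then show ?case by (simp add: awalk_Nil_iff)
next
  case (Cons e p)
  then have "e \<in> parcs G" "fst e = x" "awalk (snd e) p v" by (auto simp: awalk_Cons_iff)
  then have "f x \<le> Suc (f (snd e))" "f (snd e) \<le> f v + length p"
    using assms(2)[of x "snd e"] Cons(1) by auto
  then show ?case by simp
qed

text \<open>Descending along \<open>f\<close> produces a walk of length \<open>f x\<close>, and
  since \<open>f\<close> drops by at most one per arc, no walk to \<open>v\<close> is shorter. All
  explicit distances below are obtained by guessing such an \<open>f\<close>.\<close>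

lemma graph_dist_eqI:
  assumes x: "x \<in> pverts G"
    and v: "f v = 0"
    and zero: "\<And>x. x \<in> pverts G \<Longrightarrow> f x = 0 \<Longrightarrow> x = v"
    and descent: "\<And>x. x \<in> pverts G \<Longrightarrow> f x \<noteq> 0 \<Longrightarrow> \<exists>y. (x, y) \<in> parcs G \<and> f x = Suc (f y)"
    and lipschitz: "\<And>x y. (x, y) \<in> parcs G \<Longrightarrow> f x \<le> Suc (f y)"
  shows "graph_dist G x v = f x"
proof -
  obtain p where p: "awalk x p v" "length p = f x"
    using awalk_of_descent[of x f v, OF x zero descent] by blast
  obtain q where q: "awalk x q v" "length q = graph_dist G x v"
    using shortest_awalk[OF p(1)] .
  show ?thesis
    using graph_dist_le[OF p(1)] lipschitz_le_length_awalk[of x q v f, OF q(1) lipschitz] p q v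
    by simp
qed

end

text \<open>\<open>connected\<close> refers to the symmetric closure of the arcs, which adds nothing
  when they already come in opposite pairs.\<close>

lemma (in pair_graph) mk_symmetric_with_proj: "mk_symmetric (with_proj G) = G"
  by (auto simp: mk_symmetric_def arcs_symmetric intro!: pair_pre_digraph.equality)

locale pair_connected_graph = pair_graph +
  assumes connected: "connected (with_proj G)"
begin

lemma awalk_ex:
  assumes "u \<in> pverts G" "v \<in> pverts G"
  shows "\<exists>p. awalk u p v"
  using connected assms
  by (auto simp: connected_def mk_symmetric_with_proj strongly_connected_def reachable_awalk)

lemma shortest_awalk_ex:
  assumes "u \<in> pverts G" "v \<in> pverts G"
  obtains p where "awalk u p v" "length p = graph_dist G u v"
  using awalk_ex[OF assms] shortest_awalk by blast

lemma graph_dist_self [simp]: "u \<in> pverts G \<Longrightarrow> graph_dist G u u = 0"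
  using graph_dist_le[of u "[]" u] by (simp add: awalk_Nil_iff)

lemma graph_dist_eq_0:
  assumes "u \<in> pverts G" "v \<in> pverts G" "graph_dist G u v = 0"
  shows "u = v"
proof -
  obtain p where "awalk u p v" "length p = 0" using shortest_awalk_ex assms by metis
  then show ?thesis by (simp add: awalk_Nil_iff)
qed

lemma graph_dist_triangle:
  assumes "u \<in> pverts G" "v \<in> pverts G" "w \<in> pverts G"
  shows "graph_dist G u w \<le> graph_dist G u v + graph_dist G v w"
proof -
  obtain p where p: "awalk u p v" "length p = graph_dist G u v"
    using shortest_awalk_ex assms by metis
  obtain q where q: "awalk v q w" "length q = graph_dist G v w"
    using shortest_awalk_ex assms by metis
  show ?thesis using graph_dist_le[of u "p @ q" w] p q by (auto intro: awalk_appendI)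
qed

lemma length_rev_path: "length (rev_path p) = length p"
  by (induct p) auto

lemma graph_dist_sym:
  assumes "u \<in> pverts G" "v \<in> pverts G"
  shows "graph_dist G u v = graph_dist G v u"
proof -
  have "graph_dist G b a \<le> graph_dist G a b" if ab: "a \<in> pverts G" "b \<in> pverts G" for a b
  proof -
    obtain p where p: "awalk a p b" "length p = graph_dist G a b"
      using shortest_awalk_ex ab by metis
    show ?thesis using graph_dist_le[of b "rev_path p" a] p by (simp add: length_rev_path)
  qed
  then show ?thesis using assms by (simp add: antisym)
qed

lemma graph_dist_arc_le:
  assumes "(u, v) \<in> parcs G"
  shows "graph_dist G u v \<le> 1"
  using graph_dist_le[of u "[(u, v)]" v] assms in_arcsD1 in_arcsD2
  by (auto simp: awalk_simps)

lemma graph_dist_lipschitz: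
  assumes "(u, v) \<in> parcs G" "w \<in> pverts G"
  shows "graph_dist G u w \<le> Suc (graph_dist G v w)"
  using graph_dist_triangle[of u v w] graph_dist_arc_le[OF assms(1)] assms(2) in_arcsD1 in_arcsD2
    assms(1) by fastforce

lemma graph_dist_descent:
  assumes "u \<in> pverts G" "v \<in> pverts G" "u \<noteq> v"
  shows "\<exists>y. (u, y) \<in> parcs G \<and> graph_dist G u v = Suc (graph_dist G y v)"
proof -
  obtain p where p: "awalk u p v" "length p = graph_dist G u v"
    using shortest_awalk_ex assms by metis
  with assms(3) obtain e q where e: "p = e # q" by (cases p) (auto simp: awalk_Nil_iff)
  with p have "e \<in> parcs G" "fst e = u" "awalk (snd e) q v" by (auto simp: awalk_Cons_iff)
  then have "(u, snd e) \<in> parcs G" "graph_dist G (snd e) v \<le> length q"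
    using graph_dist_le by auto
  then show ?thesis using graph_dist_lipschitz[of u "snd e" v] assms p e
    by (intro exI[of _ "snd e"]) auto
qed

end

section \<open>Metric dimension\<close>

text \<open>Reordering a resolving set only permutes coordinates, so sets replace lists from here
  on.\<close>

definition resolves :: "'a pair_pre_digraph \<Rightarrow> 'a set \<Rightarrow> bool" where
  "resolves G S \<longleftrightarrow> S \<subseteq> pverts G \<and>
     (\<forall>u \<in> pverts G. \<forall>v \<in> pverts G.
        (\<forall>w \<in> S. graph_dist G u w = graph_dist G v w) \<longrightarrow> u = v)"

lemma resolving_set_iff_resolves: "resolving_set G W \<longleftrightarrow> distinct W \<and> resolves G (set W)"
  by (auto simp: resolving_set_def resolves_def representation_def)

lemma resolvesD:
  assumes "resolves G S" "u \<in> pverts G" "v \<in> pverts G"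
    and "\<And>w. w \<in> S \<Longrightarrow> graph_dist G u w = graph_dist G v w"
  shows "u = v"
  using assms by (auto simp: resolves_def)

lemma metric_dim_le:
  assumes "resolves G S" "finite S"
  shows "metric_dim G \<le> card S"
proof -
  obtain W where "set W = S" "distinct W" using finite_distinct_list[OF assms(2)] by blast
  then have "resolving_set G W \<and> length W = card S"
    using assms(1) distinct_card[of W] by (simp add: resolving_set_iff_resolves)
  then show ?thesis unfolding metric_dim_def by (blast intro: Least_le)
qed

lemma metric_basis:
  assumes "resolves G S" "finite S"
  obtains B where "resolves G B" "finite B" "card B = metric_dim G"
proof -
  obtain W where "set W = S" "distinct W" using finite_distinct_list[OF assms(2)] by blast
  then have "\<exists>W. resolving_set G W \<and> length W = length W"
    using assms(1) by (auto simp: resolving_set_iff_resolves)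
  then have "\<exists>k W. resolving_set G W \<and> length W = k" by blast
  then have "\<exists>W. resolving_set G W \<and> length W = metric_dim G"
    unfolding metric_dim_def by (rule LeastI_ex)
  then show ?thesis using that
    by (metis List.finite_set distinct_card resolving_set_iff_resolves)
qed

context pair_connected_graph
begin

text \<open>A vertex of \<open>S\<close> is the only one at distance 0 from itself, so two confused
  vertices would both lie outside \<open>S\<close>.\<close>

lemma resolves_if_misses_at_most_one:
  assumes "S \<subseteq> pverts G" "card (pverts G - S) \<le> 1"
  shows "resolves G S"
proof -
  have "u = v" if uv: "u \<in> pverts G" "v \<in> pverts G"
    and eq: "\<And>w. w \<in> S \<Longrightarrow> graph_dist G u w = graph_dist G v w" for u v
  proof (cases "u \<in> S \<or> v \<in> S")
    case True
    then show ?thesis using eq uv graph_dist_self graph_dist_eq_0 by metis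
  next
    case False
    then have "u \<in> pverts G - S" "v \<in> pverts G - S" using uv by auto
    moreover have "is_singleton (pverts G - S) \<or> pverts G - S = {}"
      using assms(2) pair_finite_verts by (auto simp: le_Suc_eq is_singleton_altdef)
    ultimately show ?thesis unfolding is_singleton_def by (metis empty_iff singletonD)
  qed
  then show ?thesis using assms(1) by (auto simp: resolves_def)
qed

lemma metric_basis_ex:
  obtains B where "resolves G B" "finite B" "card B = metric_dim G"
  using metric_basis[of G "pverts G"] resolves_if_misses_at_most_one[of "pverts G"] pair_finite_verts
  by auto

text \<open>Vertices with a geodesic through \<open>r\<close> to every vertex of \<open>S\<close>.
  With \<open>r\<close> the terminal, distances to \<open>S\<close> do not distinguish such a vertex
  from one in another component at the same distance from \<open>r\<close>.\<close>

definition through :: "'a \<Rightarrow> 'a set \<Rightarrow> 'a \<Rightarrow> bool" where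
  "through r S u \<longleftrightarrow> u \<in> pverts G \<and> u \<noteq> r \<and>
     (\<forall>w \<in> S. graph_dist G u w = graph_dist G u r + graph_dist G r w)"

text \<open>Take the neighbour \<open>y\<close> of \<open>r\<close> on a geodesic from
  \<open>r\<close> to \<open>u\<close>. If \<open>y\<close> were closer to some \<open>w\<close>
  than by the route through \<open>r\<close>, then so would be \<open>u\<close>.\<close>

lemma through_neighbour:
  assumes r: "r \<in> pverts G" and S: "S \<subseteq> pverts G" and u: "through r S u"
  shows "\<exists>x. through r S x \<and> graph_dist G x r = 1"
proof -
  have uV: "u \<in> pverts G" "r \<noteq> u" using u by (auto simp: through_def)
  obtain y where y: "(r, y) \<in> parcs G" "graph_dist G r u = Suc (graph_dist G y u)"
    using graph_dist_descent[of r u] r uV by auto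
  have yV: "y \<in> pverts G" using y in_arcsD2 by auto
  have yr: "graph_dist G y r \<le> 1"
    using graph_dist_arc_le y(1) arcs_symmetric by blast
  have ur: "graph_dist G u r = Suc (graph_dist G u y)"
    using y(2) graph_dist_sym uV yV r by simp
  have "graph_dist G y w = 1 + graph_dist G r w" if w: "w \<in> S" for w
  proof -
    have "graph_dist G u w = graph_dist G u r + graph_dist G r w"
      using u w by (auto simp: through_def)
    moreover have "graph_dist G u w \<le> graph_dist G u y + graph_dist G y w"
      "graph_dist G y w \<le> graph_dist G y r + graph_dist G r w"
      using graph_dist_triangle uV yV r w S by auto
    ultimately show ?thesis using yr ur by simp
  qed
  moreover have "graph_dist G y r = 1"
    using graph_dist_triangle[of u y r] uV yV r yr ur by simp
  ultimately show ?thesis using yV r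
    by (intro exI[of _ y]) (auto simp: through_def)
qed

text \<open>
  A resolving set allows at most one vertex in \<open>through r B\<close> at distance 1 from \<open>r\<close>. By
  \<open>through_neighbour\<close>, adding this vertex to \<open>B\<close> leaves no vertex in \<open>through\<close> at any distance.
\<close>

lemma extend_to_no_through:
  assumes r: "r \<in> pverts G" and B: "resolves G B" "finite B"
  obtains X where "resolves G X" "finite X" "card X \<le> card B + 1" "\<And>u. \<not> through r X u"
proof (cases "\<exists>x. through r B x \<and> graph_dist G x r = 1")
  case False
  then have "\<not> through r B u" for u
    using through_neighbour[of r B u] r B by (auto simp: resolves_def)
  then show ?thesis using that[of B] B by simp
next
  case True
  then obtain b where b: "through r B b" "graph_dist G b r = 1" by auto
  have bV: "b \<in> pverts G" using b by (simp add: through_def)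
  have no: "\<not> through r (insert b B) u" for u
  proof
    assume "through r (insert b B) u"
    then obtain x where x: "through r (insert b B) x" "graph_dist G x r = 1"
      using through_neighbour[of r "insert b B" u] r B bV by (auto simp: resolves_def)
    \<comment> \<open>Both have distance \<open>1 + graph_dist G r w\<close> to every
      \<open>w\<close> in \<open>B\<close>.\<close>
    have "x = b"
      using B(1) by (rule resolvesD) (use x b bV in \<open>auto simp: through_def\<close>)
    \<comment> \<open>\<open>b\<close> is in the enlarged set at distance 0 from itself, but the
      route through \<open>r\<close> has positive length.\<close>
    then show False using x bV by (simp add: through_def)
  qed
  have "resolves G (insert b B)" using B(1) bV by (auto simp: resolves_def)
  moreover have "card (insert b B) \<le> card B + 1" using B(2) by (simp add: card_insert_if)
  ultimately show ?thesis using that[of "insert b B"] B(2) no by blast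
qed

end

section \<open>Vertex amalgamations\<close>

locale rooted_family =
  fixes n :: nat and G :: "nat \<Rightarrow> 'a pair_pre_digraph" and t :: "nat \<Rightarrow> 'a"
  assumes rooted: "rooted_graphs n G t"
begin

abbreviation amal ("A") where "A \<equiv> vertex_amal n G t"
abbreviation emb ("\<iota>") where "\<iota> \<equiv> amal_vertex t"

lemma component: "i \<in> {1..n} \<Longrightarrow> pair_connected_graph (G i)"
  using rooted by (auto simp: rooted_graphs_def pair_connected_graph_def pair_connected_graph_axioms_def)

lemma terminal_in_verts: "i \<in> {1..n} \<Longrightarrow> t i \<in> pverts (G i)"
  using rooted by (auto simp: rooted_graphs_def)

lemma emb_terminal [simp]: "\<iota> i (t i) = None"
  by (simp add: amal_vertex_def)

lemma emb_eq_iff [simp]: "\<iota> i u = \<iota> i v \<longleftrightarrow> u = v"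
  by (auto simp: amal_vertex_def)

lemma emb_eq_emb_iff: "i \<noteq> j \<Longrightarrow> \<iota> i u = \<iota> j v \<longleftrightarrow> u = t i \<and> v = t j"
  by (auto simp: amal_vertex_def)

lemma verts_amal: "pverts A = (\<Union>i \<in> {1..n}. \<iota> i ` pverts (G i))"
  by (simp add: vertex_amal_def)

lemma arcs_amal: "parcs A = (\<Union>i \<in> {1..n}. map_prod (\<iota> i) (\<iota> i) ` parcs (G i))"
  by (simp add: vertex_amal_def)

lemma emb_in_verts [intro]: "i \<in> {1..n} \<Longrightarrow> u \<in> pverts (G i) \<Longrightarrow> \<iota> i u \<in> pverts A"
  by (auto simp: verts_amal)

lemma verts_amalE:
  assumes "x \<in> pverts A"
  obtains i u where "i \<in> {1..n}" "u \<in> pverts (G i)" "x = \<iota> i u"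
  using assms unfolding verts_amal by blast

lemma emb_in_arcs: "i \<in> {1..n} \<Longrightarrow> (u, v) \<in> parcs (G i) \<Longrightarrow> (\<iota> i u, \<iota> i v) \<in> parcs A"
  by (force simp: arcs_amal)

lemma pair_wf_digraph_amal: "pair_wf_digraph A"
proof
  fix e assume "e \<in> parcs A"
  then obtain i u v where e: "i \<in> {1..n}" "(u, v) \<in> parcs (G i)" "e = (\<iota> i u, \<iota> i v)"
    by (auto simp: arcs_amal)
  interpret pair_connected_graph "G i" using component e by blast
  show "fst e \<in> pverts A" "snd e \<in> pverts A"
    using e in_arcsD1 in_arcsD2 by auto
qed

lemma finite_verts_amal: "finite (pverts A)"
  using rooted by (auto simp: verts_amal rooted_graphs_def pair_graph_def pair_digraph_def
      pair_fin_digraph_def pair_fin_digraph_axioms_def)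

section \<open>Distances in the amalgamation\<close>

definition amal_dist :: "nat \<Rightarrow> 'a \<Rightarrow> (nat \<times> 'a) option \<Rightarrow> nat" where
  "amal_dist j v x = (case x of
       None \<Rightarrow> graph_dist (G j) (t j) v
     | Some (i, u) \<Rightarrow> if i = j then graph_dist (G j) u v
                   else graph_dist (G i) u (t i) + graph_dist (G j) (t j) v)"

text \<open>The common vertex has one preimage in every component; the formula agrees on all of them
  because \<open>graph_dist (G i) (t i) (t i)\<close> is 0.\<close>

lemma amal_dist_emb:
  assumes "i \<in> {1..n}" "u \<in> pverts (G i)"
  shows "amal_dist j v (\<iota> i u) = (if i = j then graph_dist (G j) u v
           else graph_dist (G i) u (t i) + graph_dist (G j) (t j) v)"
proof -
  interpret pair_connected_graph "G i" using component assms by blast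
  show ?thesis using terminal_in_verts[OF assms(1)] by (auto simp: amal_dist_def amal_vertex_def)
qed

text \<open>\<open>amal_dist j v\<close> is the potential for \<open>graph_dist_eqI\<close>: from
  another component one descends to the terminal first, and then inside \<open>G j\<close> towards
  \<open>v\<close>.\<close>

lemma graph_dist_amal:
  assumes i: "i \<in> {1..n}" "u \<in> pverts (G i)" and j: "j \<in> {1..n}" "v \<in> pverts (G j)"
  shows "graph_dist A (\<iota> i u) (\<iota> j v) = (if i = j then graph_dist (G j) u v
           else graph_dist (G i) u (t i) + graph_dist (G j) (t j) v)"
proof -
  interpret wf: pair_wf_digraph A by (rule pair_wf_digraph_amal)
  interpret J: pair_connected_graph "G j" using component j by blast
  have tj: "t j \<in> pverts (G j)" using terminal_in_verts j by blast
  have "graph_dist A (\<iota> i u) (\<iota> j v) = amal_dist j v (\<iota> i u)"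
  proof (rule wf.graph_dist_eqI)
    show "\<iota> i u \<in> pverts A" using i by blast
    show "amal_dist j v (\<iota> j v) = 0" using j by (simp add: amal_dist_emb)
  next
    fix x assume x: "x \<in> pverts A" "amal_dist j v x = 0"
    obtain k y where y: "k \<in> {1..n}" "y \<in> pverts (G k)" "x = \<iota> k y"
      using x(1) by (rule verts_amalE)
    interpret K: pair_connected_graph "G k" using component y by blast
    show "x = \<iota> j v"
    proof (cases "k = j")
      case True
      then show ?thesis
        using x(2) y J.graph_dist_eq_0[of y v] j by (simp add: amal_dist_emb)
    next
      case False
      then have "y = t k" "t j = v"
        using x(2) y K.graph_dist_eq_0[of y "t k"] J.graph_dist_eq_0[of "t j" v] j tj
          terminal_in_verts[OF y(1)] by (simp_all add: amal_dist_emb)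
      then show ?thesis using y(3) by (metis emb_terminal)
    qed
  next
    fix x assume x: "x \<in> pverts A" "amal_dist j v x \<noteq> 0"
    have in_j: "\<exists>z. (\<iota> j y, z) \<in> parcs A \<and> amal_dist j v (\<iota> j y) = Suc (amal_dist j v z)"
      if y: "y \<in> pverts (G j)" "amal_dist j v (\<iota> j y) \<noteq> 0" for y
    proof -
      have "y \<noteq> v" using y j by (auto simp: amal_dist_emb)
      then obtain z where "(y, z) \<in> parcs (G j)" "graph_dist (G j) y v = Suc (graph_dist (G j) z v)"
        using J.graph_dist_descent y j by blast
      then show ?thesis using j y J.in_arcsD2
        by (intro exI[of _ "\<iota> j z"]) (auto simp: amal_dist_emb emb_in_arcs)
    qed
    obtain k y where y: "k \<in> {1..n}" "y \<in> pverts (G k)" "x = \<iota> k y"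
      using x(1) by (rule verts_amalE)
    interpret K: pair_connected_graph "G k" using component y by blast
    show "\<exists>z. (x, z) \<in> parcs A \<and> amal_dist j v x = Suc (amal_dist j v z)"
    proof (cases "k = j \<or> y = t k")
      \<comment> \<open>The common vertex is read as the terminal of \<open>G j\<close>, since the
        descent has to continue there.\<close>
      case True
      then obtain y' where "x = \<iota> j y'" "y' \<in> pverts (G j)"
        using y tj emb_terminal by metis
      then show ?thesis using in_j[of y'] x(2) by simp
    next
      case False
      then obtain z where "(y, z) \<in> parcs (G k)"
        "graph_dist (G k) y (t k) = Suc (graph_dist (G k) z (t k))"
        using K.graph_dist_descent y terminal_in_verts by blast
      then show ?thesis using False y K.in_arcsD2
        by (intro exI[of _ "\<iota> k z"]) (auto simp: amal_dist_emb emb_in_arcs)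
    qed
  next
    fix x y assume "(x, y) \<in> parcs A"
    then obtain k a b where ab: "k \<in> {1..n}" "(a, b) \<in> parcs (G k)" "x = \<iota> k a" "y = \<iota> k b"
      by (auto simp: arcs_amal)
    interpret K: pair_connected_graph "G k" using component ab by blast
    show "amal_dist j v x \<le> Suc (amal_dist j v y)"
      using ab K.in_arcsD1[OF ab(2)] K.in_arcsD2[OF ab(2)] j terminal_in_verts[OF ab(1)]
        K.graph_dist_lipschitz[OF ab(2)]
      by (auto simp: amal_dist_emb)
  qed
  then show ?thesis using i by (simp add: amal_dist_emb)
qed

text \<open>A vertex of \<open>W\<close> in another component sees \<open>u\<close> only through the
  distance from \<open>u\<close> to \<open>t i\<close>, so the single vertex \<open>t i\<close>
  replaces all of these.\<close>

lemma resolves_component: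
  assumes W: "resolves A W" and i: "i \<in> {1..n}"
  shows "resolves (G i) (insert (t i) {v \<in> pverts (G i). Some (i, v) \<in> W})"
    (is "resolves _ ?S")
  unfolding resolves_def
proof (intro conjI ballI impI)
  interpret I: pair_connected_graph "G i" using component i by blast
  show "?S \<subseteq> pverts (G i)" using terminal_in_verts i by auto
  fix u v assume u: "u \<in> pverts (G i)" and v: "v \<in> pverts (G i)"
    and eq: "\<forall>w \<in> ?S. graph_dist (G i) u w = graph_dist (G i) v w"
  have "\<iota> i u = \<iota> i v"
    using W
  proof (rule resolvesD)
    show "\<iota> i u \<in> pverts A" "\<iota> i v \<in> pverts A" using i u v by auto
    fix x assume "x \<in> W"
    then obtain k w where w: "k \<in> {1..n}" "w \<in> pverts (G k)" "x = \<iota> k w"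
      using W by (auto simp: resolves_def verts_amal)
    show "graph_dist A (\<iota> i u) x = graph_dist A (\<iota> i v) x"
    proof (cases "k = i")
      case True
      then have "w \<in> ?S" using w \<open>x \<in> W\<close> by (auto simp: amal_vertex_def split: if_splits)
      then show ?thesis using eq i u v w True by (auto simp: graph_dist_amal)
    next
      case False
      then show ?thesis using eq i u v w by (auto simp: graph_dist_amal)
    qed
  qed
  then show "u = v" by simp
qed

text \<open>By the distance formula only equal vertices are at distance 0, so the whole vertex set
  resolves and the minimum is attained.\<close>

lemma amal_basis:
  obtains W where "resolves A W" "finite W" "card W = metric_dim A"
proof -
  have self: "graph_dist A x y = 0 \<longleftrightarrow> x = y" if xy: "x \<in> pverts A" "y \<in> pverts A" for x y
  proof -
    obtain i u where u: "i \<in> {1..n}" "u \<in> pverts (G i)" "x = \<iota> i u"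
      using xy(1) by (rule verts_amalE)
    obtain j v where v: "j \<in> {1..n}" "v \<in> pverts (G j)" "y = \<iota> j v"
      using xy(2) by (rule verts_amalE)
    interpret I: pair_connected_graph "G i" using component u by blast
    interpret J: pair_connected_graph "G j" using component v by blast
    show ?thesis
    proof (cases "i = j")
      case True
      then show ?thesis using u v I.graph_dist_eq_0[of u v] by (auto simp: graph_dist_amal)
    next
      case False
      then show ?thesis
        using u v I.graph_dist_eq_0[of u "t i"] J.graph_dist_eq_0[of "t j" v]
          terminal_in_verts[OF u(1)] terminal_in_verts[OF v(1)]
        by (auto simp: graph_dist_amal emb_eq_emb_iff)
    qed
  qed
  then have "resolves A (pverts A)"
    unfolding resolves_def by (metis subset_refl)
  then show ?thesis using that metric_basis finite_verts_amal by blast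
qed

text \<open>The traces of a basis on the components are disjoint, and each resolves its component
  after adding one vertex, the terminal. This costs at most \<open>n\<close> vertices in
  total.\<close>

lemma metric_dim_amal_ge: "(\<Sum>i = 1..n. metric_dim (G i)) \<le> metric_dim A + n"
proof -
  obtain W where W: "resolves A W" "finite W" "card W = metric_dim A" by (rule amal_basis)
  let ?S = "\<lambda>i. {v \<in> pverts (G i). Some (i, v) \<in> W}"
  have fin: "finite (?S i)" for i
    by (rule finite_imageD[of "\<lambda>v. Some (i, v)"])
      (auto intro!: finite_subset[OF _ W(2)] simp: inj_on_def)
  have "metric_dim (G i) \<le> card (?S i) + 1" if i: "i \<in> {1..n}" for i
  proof -
    have "metric_dim (G i) \<le> card (insert (t i) (?S i))"
      using metric_dim_le resolves_component[OF W(1) i] fin by blast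
    then show ?thesis using fin[of i] by (simp add: card_insert_if split: if_splits)
  qed
  then have "(\<Sum>i = 1..n. metric_dim (G i)) \<le> (\<Sum>i = 1..n. card (?S i) + 1)"
    by (rule sum_mono)
  also have "\<dots> = card (Sigma {1..n} ?S) + n"
    using fin by (simp only: sum.distrib) simp
  also have "card (Sigma {1..n} ?S) \<le> card W"
    by (rule card_inj_on_le[where f = Some]) (use W in auto)
  finally show ?thesis using W by simp
qed

text \<open>Confusing non-terminal vertices of two different components forces both to be in
  \<open>through\<close>. At least one of the two components is not the \<open>n\<close>-th, so one
  exceptional component is harmless.\<close>

lemma resolves_amal:
  assumes X: "\<And>i. i \<in> {1..n} \<Longrightarrow> resolves (G i) (X i)"
    and no: "\<And>i u. i \<in> {1..n} \<Longrightarrow> i \<noteq> n \<Longrightarrow> \<not> pair_connected_graph.through (G i) (t i) (X i) u"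
  shows "resolves A (\<Union>i \<in> {1..n}. \<iota> i ` X i)"
  unfolding resolves_def
proof (intro conjI ballI impI)
  have XV: "X i \<subseteq> pverts (G i)" if "i \<in> {1..n}" for i
    using X[OF that] by (simp add: resolves_def)
  let ?S = "\<Union>i \<in> {1..n}. \<iota> i ` X i"
  show "?S \<subseteq> pverts A" using XV by (blast intro: emb_in_verts)
  fix x y assume xy: "x \<in> pverts A" "y \<in> pverts A"
    and eq: "\<forall>w \<in> ?S. graph_dist A x w = graph_dist A y w"
  have same: "x = y" if "i \<in> {1..n}" "u \<in> pverts (G i)" "v \<in> pverts (G i)" "x = \<iota> i u" "y = \<iota> i v"
    for i u v
  proof -
    have "graph_dist (G i) u w = graph_dist (G i) v w" if w: "w \<in> X i" for w
    proof -
      have "w \<in> pverts (G i)" using w XV \<open>i \<in> {1..n}\<close> by blast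
      moreover have "graph_dist A x (\<iota> i w) = graph_dist A y (\<iota> i w)"
        using w eq \<open>i \<in> {1..n}\<close> by blast
      ultimately show ?thesis
        using graph_dist_amal \<open>i \<in> {1..n}\<close> \<open>u \<in> _\<close> \<open>v \<in> _\<close> \<open>x = _\<close> \<open>y = _\<close> by simp
    qed
    then show ?thesis using X that resolvesD by metis
  qed
  obtain i u where u: "i \<in> {1..n}" "u \<in> pverts (G i)" "x = \<iota> i u"
    using xy(1) by (rule verts_amalE)
  obtain j v where v: "j \<in> {1..n}" "v \<in> pverts (G j)" "y = \<iota> j v"
    using xy(2) by (rule verts_amalE)
  interpret I: pair_connected_graph "G i" using component u by blast
  interpret J: pair_connected_graph "G j" using component v by blast
  have ti: "t i \<in> pverts (G i)" and tj: "t j \<in> pverts (G j)" using terminal_in_verts u v by auto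
  show "x = y"
  proof (cases "i = j \<or> u = t i \<or> v = t j")
    case True
    then show ?thesis using same u v ti tj emb_terminal by metis
  next
    case False
    have wi: "graph_dist (G i) u w = graph_dist (G j) v (t j) + graph_dist (G i) (t i) w"
      if w: "w \<in> X i" for w
    proof -
      have "w \<in> pverts (G i)" using w XV u(1) by blast
      moreover have "graph_dist A x (\<iota> i w) = graph_dist A y (\<iota> i w)" using w eq u(1) by blast
      ultimately show ?thesis using graph_dist_amal u v False by simp
    qed
    have wj: "graph_dist (G j) v w = graph_dist (G i) u (t i) + graph_dist (G j) (t j) w"
      if w: "w \<in> X j" for w
    proof -
      have "w \<in> pverts (G j)" using w XV v(1) by blast
      moreover have "graph_dist A x (\<iota> j w) = graph_dist A y (\<iota> j w)" using w eq v(1) by blast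
      ultimately show ?thesis using graph_dist_amal u v False by simp
    qed
    \<comment> \<open>The empty set resolves only a single vertex, but \<open>u\<close> and
      \<open>t i\<close> differ, as do \<open>v\<close> and \<open>t j\<close>.\<close>
    have "X i \<noteq> {}" "X j \<noteq> {}"
      using resolvesD[OF X[OF u(1)] u(2) ti] resolvesD[OF X[OF v(1)] v(2) tj] False by auto
    then obtain a b where ab: "a \<in> X i" "b \<in> X j" by auto
    then have "a \<in> pverts (G i)" "b \<in> pverts (G j)" using XV u(1) v(1) by auto
    \<comment> \<open>The triangle inequality for \<open>u\<close> and \<open>a\<close> gives \<le>,
      the one for \<open>v\<close> and \<open>b\<close> gives the converse.\<close>
    then have "graph_dist (G j) v (t j) = graph_dist (G i) u (t i)"
      using wi[OF ab(1)] wj[OF ab(2)] I.graph_dist_triangle[of u "t i" a]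
        J.graph_dist_triangle[of v "t j" b] u v ti tj by auto
    then have "I.through (t i) (X i) u" "J.through (t j) (X j) v"
      using wi wj u v False by (auto simp: I.through_def J.through_def)
    then show ?thesis using no u v False by blast
  qed
qed

text \<open>Component \<open>n\<close> keeps its basis, and each of the other \<open>n - 1\<close>
  bases grows by at most one vertex.\<close>

lemma metric_dim_amal_le:
  assumes "n \<ge> 1"
  shows "metric_dim A + 1 \<le> (\<Sum>i = 1..n. metric_dim (G i)) + n"
proof -
  have "\<exists>X. resolves (G i) X \<and> finite X \<and>
      card X \<le> metric_dim (G i) + (if i = n then 0 else 1) \<and>
      (i \<noteq> n \<longrightarrow> (\<forall>u. \<not> pair_connected_graph.through (G i) (t i) X u))"
    if i: "i \<in> {1..n}" for i
  proof -
    interpret I: pair_connected_graph "G i" using component i by blast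
    obtain B where B: "resolves (G i) B" "finite B" "card B = metric_dim (G i)"
      by (rule I.metric_basis_ex)
    show ?thesis
    proof (cases "i = n")
      case True
      then show ?thesis using B by auto
    next
      case False
      obtain X where "resolves (G i) X" "finite X" "card X \<le> card B + 1" "\<And>u. \<not> I.through (t i) X u"
        using I.extend_to_no_through[OF terminal_in_verts[OF i] B(1,2)] by blast
      then show ?thesis using B(3) False by (intro exI[of _ X]) simp
    qed
  qed
  then obtain X where X: "\<And>i. i \<in> {1..n} \<Longrightarrow> resolves (G i) (X i) \<and> finite (X i) \<and>
      card (X i) \<le> metric_dim (G i) + (if i = n then 0 else 1) \<and>
      (i \<noteq> n \<longrightarrow> (\<forall>u. \<not> pair_connected_graph.through (G i) (t i) (X i) u))"
    by metis
  have "metric_dim A \<le> card (\<Union>i \<in> {1..n}. \<iota> i ` X i)"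
    using X by (intro metric_dim_le resolves_amal) auto
  also have "\<dots> \<le> (\<Sum>i = 1..n. card (\<iota> i ` X i))" by (rule card_UN_le) simp
  also have "\<dots> \<le> (\<Sum>i = 1..n. metric_dim (G i) + (if i = n then 0 else 1))"
    using X card_image_le le_trans by (intro sum_mono) blast
  also have "\<dots> = (\<Sum>i = 1..n. metric_dim (G i)) + (\<Sum>i = 1..n. if i = n then 0 else 1)"
    by (rule sum.distrib)
  finally have "metric_dim A \<le> (\<Sum>i = 1..n. metric_dim (G i)) + (\<Sum>i = 1..n. if i = n then 0 else 1)" .
  moreover have "(\<Sum>i = 1..n. if i = n then 0 else 1) + 1 = n"
  proof -
    have "{1..n} = insert n {1..<n}" using assms by auto
    then show ?thesis using assms by simp
  qed
  ultimately show ?thesis by linarith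
qed

end

section \<open>Twin classes and metric dimension\<close>

lemma card_le_of_twin_classes:
  assumes S: "resolves G S" "finite S" and T: "T \<subseteq> pverts G" "finite T"
    and twins: "\<And>u v w. u \<in> T \<Longrightarrow> v \<in> T \<Longrightarrow> \<kappa> u = \<kappa> v \<Longrightarrow> u \<noteq> v \<Longrightarrow>
      w \<in> pverts G \<Longrightarrow> w \<noteq> u \<Longrightarrow> w \<noteq> v \<Longrightarrow> graph_dist G u w = graph_dist G v w"
  shows "card T \<le> card S + card (\<kappa> ` T)"
proof -
  \<comment> \<open>Two twins outside \<open>S\<close> would have equal distances to all of
    \<open>S\<close>, so \<open>S\<close> misses at most one vertex of each class.\<close>
  have "inj_on \<kappa> (T - S)"
  proof (rule inj_onI, rule ccontr)
    fix u v assume uv: "u \<in> T - S" "v \<in> T - S" "\<kappa> u = \<kappa> v" "u \<noteq> v"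
    have "u = v"
      using S(1)
    proof (rule resolvesD)
      show "graph_dist G u w = graph_dist G v w" if "w \<in> S" for w
        using that uv S(1) by (intro twins) (auto simp: resolves_def)
    qed (use uv T in auto)
    with uv show False by simp
  qed
  then have "card (T - S) \<le> card (\<kappa> ` T)"
    by (rule card_inj_on_le) (use T in auto)
  moreover have "card T \<le> card S + card (T - S)"
    using card_mono[of "S \<union> (T - S)" T] card_Un_le[of S "T - S"] S T by auto
  ultimately show ?thesis by simp
qed

text \<open>Around a centre \<open>c\<close> adjacent to everything, nonzero classes are cliques and
  class 0 is independent. All but one vertex of each class resolve the graph, and the twin bound
  shows that fewer do not.\<close>

lemma metric_dim_of_twin_classes:
  fixes \<kappa> :: "'a \<Rightarrow> nat"
  assumes V: "pverts G = insert c P" "c \<notin> P" "finite P"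
    and c: "\<And>x. x \<in> P \<Longrightarrow> graph_dist G c x = 1" "\<And>x. x \<in> P \<Longrightarrow> graph_dist G x c = 1"
    and d: "\<And>x y. x \<in> P \<Longrightarrow> y \<in> P \<Longrightarrow> graph_dist G x y =
      (if x = y then 0 else if \<kappa> x = \<kappa> y \<and> \<kappa> x \<noteq> 0 then 1 else 2)"
    and clique: "\<And>x. x \<in> P \<Longrightarrow> \<kappa> x \<noteq> 0 \<Longrightarrow> \<exists>y \<in> P. y \<noteq> x \<and> \<kappa> y = \<kappa> x"
    and sep: "\<And>x. x \<in> P \<Longrightarrow>
      \<exists>y \<in> P. \<exists>z \<in> P. y \<noteq> z \<and> \<kappa> y = \<kappa> z \<and> \<not> (\<kappa> y = \<kappa> x \<and> \<kappa> x \<noteq> 0)"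
  shows "metric_dim G + card (\<kappa> ` P) = card P"
proof -
  \<comment> \<open>\<open>R\<close> is the set of omitted vertices, one from each class.\<close>
  obtain R where R: "R \<subseteq> P" "inj_on \<kappa> R" "\<kappa> ` P = \<kappa> ` R"
    by (metis subset_image_inj order_refl)
  let ?S = "P - R"
  have self: "graph_dist G x y \<noteq> graph_dist G y y" if "x \<in> insert c P" "y \<in> P" "x \<noteq> y" for x y
    using that c(1)[of y] d[of x y] d[of y y] by (cases "x = c") simp_all
  have "resolves G ?S"
  proof -
    have "u = v" if uv: "u \<in> insert c P" "v \<in> insert c P"
      and eq: "\<And>w. w \<in> ?S \<Longrightarrow> graph_dist G u w = graph_dist G v w" for u v
    proof (rule ccontr)
      assume ne: "u \<noteq> v"
      have "u \<notin> ?S" using eq[of u] self[of v u] uv ne by fastforce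
      moreover have "v \<notin> ?S" using eq[of v] self[of u v] uv ne by fastforce
      ultimately have uvR: "u \<in> insert c R" "v \<in> insert c R" using uv by auto
      \<comment> \<open>The centre has distance 1 to all of \<open>P\<close>, so a kept vertex at
        distance 2 from \<open>x\<close> is wanted. Of the two vertices from \<open>sep\<close>, at
        most one is omitted; the other is at distance 2 from \<open>x\<close>.\<close>
      have no_c: "\<exists>w \<in> ?S. graph_dist G x w \<noteq> graph_dist G c w" if x: "x \<in> R" for x
      proof -
        obtain y z where yz: "y \<in> P" "z \<in> P" "y \<noteq> z" "\<kappa> y = \<kappa> z" "\<not> (\<kappa> y = \<kappa> x \<and> \<kappa> x \<noteq> 0)"
          using sep x R(1) by blast
        then obtain w where "w \<in> ?S" "\<not> (\<kappa> w = \<kappa> x \<and> \<kappa> x \<noteq> 0)"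
          using R(2) by (metis DiffI inj_onD)
        moreover from this have "w \<in> P" "x \<in> P" "x \<noteq> w" using x R(1) by auto
        ultimately show ?thesis using c(1)[of w] d[of x w]
          by (intro bexI[of _ w]) (auto split: if_splits)
      qed
      \<comment> \<open>Another member of the clique of \<open>x\<close> is kept; it is at distance
        1 from \<open>x\<close> and 2 from \<open>y\<close>, which lies in a different
        class.\<close>
      have clique_sep: "\<exists>w \<in> ?S. graph_dist G x w \<noteq> graph_dist G y w"
        if xy: "x \<in> R" "y \<in> R" "x \<noteq> y" "\<kappa> x \<noteq> 0" for x y
      proof -
        obtain w where w: "w \<in> P" "w \<noteq> x" "\<kappa> w = \<kappa> x" using clique xy R(1) by blast
        then have "w \<in> ?S" using R(2) xy by (auto dest: inj_onD)
        moreover have "\<kappa> x \<noteq> \<kappa> y" using R(2) xy by (auto dest: inj_onD)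
        moreover have "x \<in> P" "y \<in> P" "y \<noteq> w" using xy R(1) \<open>w \<in> ?S\<close> by auto
        ultimately show ?thesis using d[of x w] d[of y w] w xy(4)
          by (intro bexI[of _ w]) auto
      qed
      consider "u = c" | "v = c" | "u \<in> R" "v \<in> R" using uvR by auto
      then show False
      proof cases
        case 3
        \<comment> \<open>Distinct representatives have distinct classes, so at most one is in class
          0.\<close>
        then have "\<kappa> u \<noteq> 0 \<or> \<kappa> v \<noteq> 0" using R(2) ne by (metis inj_onD)
        then show ?thesis using clique_sep[of u v] clique_sep[of v u] 3 ne eq by metis
      qed (use no_c uvR ne eq in \<open>metis insertE\<close>)+
    qed
    then show ?thesis using V(1) by (auto simp: resolves_def)
  qed
  then have "metric_dim G \<le> card ?S" using metric_dim_le V(3) by blast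
  moreover have "card ?S + card (\<kappa> ` P) = card P"
    using R V(3) by (simp add: card_image card_Diff_subset finite_subset card_mono)
  moreover have "card P \<le> metric_dim G + card (\<kappa> ` P)"
  proof -
    obtain B where B: "resolves G B" "finite B" "card B = metric_dim G"
      using metric_basis[OF \<open>resolves G ?S\<close>] V(3) by blast
    have "card P \<le> card B + card (\<kappa> ` P)"
      using B(1,2) by (rule card_le_of_twin_classes) (use V c d in auto)
    then show ?thesis using B(3) by simp
  qed
  ultimately show ?thesis by simp
qed

section \<open>Amalgamations of complete graphs and stars\<close>

text \<open>The complete graph on \<open>m + 1\<close> vertices or the star with centre 0 and
  \<open>m\<close> leaves; vertex 0 will be the terminal. For \<open>m = 1\<close> both are a single
  edge.\<close>

definition block :: "bool \<Rightarrow> nat \<Rightarrow> nat pair_pre_digraph" where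
  "block full m = \<lparr> pverts = {0..m},
     parcs = {(u, v). u \<le> m \<and> v \<le> m \<and> u \<noteq> v \<and> (full \<or> u = 0 \<or> v = 0)} \<rparr>"

lemma block_simps [simp]:
  "pverts (block b m) = {0..m}"
  "(u, v) \<in> parcs (block b m) \<longleftrightarrow> u \<le> m \<and> v \<le> m \<and> u \<noteq> v \<and> (b \<or> u = 0 \<or> v = 0)"
  by (auto simp: block_def)

lemma pair_graph_block: "pair_graph (block b m)"
proof -
  have "finite (parcs (block b m))"
    by (rule finite_subset[of _ "{0..m} \<times> {0..m}"]) auto
  then show ?thesis by unfold_locales (auto simp: symmetric_def intro!: symI)
qed

lemma pair_connected_graph_block: "pair_connected_graph (block b m)"
proof -
  interpret pair_graph "block b m" by (rule pair_graph_block)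
  have "\<exists>p. awalk u p v" if "u \<le> m" "v \<le> m" for u v
    by (rule exI[of _ "if u = v then [] else if u = 0 \<or> v = 0 then [(u, v)] else [(u, 0), (0, v)]"])
      (use that in \<open>auto simp: awalk_simps\<close>)
  then have "strongly_connected (with_proj (block b m))"
    by (intro strongly_connectedI) (auto simp: reachable_awalk)
  then show ?thesis
    by unfold_locales (simp add: connected_def mk_symmetric_with_proj)
qed

lemma graph_dist_block:
  assumes "u \<le> m" "v \<le> m"
  shows "graph_dist (block b m) u v = (if u = v then 0 else if b \<or> u = 0 \<or> v = 0 then 1 else 2)"
proof -
  interpret pair_connected_graph "block b m" by (rule pair_connected_graph_block)
  show ?thesis
  proof (rule graph_dist_eqI)
    fix x assume x: "x \<in> pverts (block b m)"
      "(if x = v then 0 else if b \<or> x = 0 \<or> v = 0 then 1 else 2 :: nat) \<noteq> 0"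
    show "\<exists>y. (x, y) \<in> parcs (block b m) \<and>
      (if x = v then 0 else if b \<or> x = 0 \<or> v = 0 then 1 else 2) =
      Suc (if y = v then 0 else if b \<or> y = 0 \<or> v = 0 then 1 else 2)"
      \<comment> \<open>Go straight to \<open>v\<close> if it is adjacent, otherwise to the
        centre.\<close>
      by (rule exI[of _ "if b \<or> x = 0 \<or> v = 0 then v else 0"])
        (use x assms in \<open>auto split: if_splits\<close>)
  qed (use assms in \<open>auto split: if_splits\<close>)
qed

text \<open>All vertices are twins of each other, so a resolving set omits at most one, and omitting
  0 works.\<close>

lemma metric_dim_block_complete: "metric_dim (block True m) = m"
proof -
  interpret pair_connected_graph "block True m" by (rule pair_connected_graph_block)
  have "{0..m} - {1..m} = {0}" by auto
  then have "resolves (block True m) {1..m}"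
    by (intro resolves_if_misses_at_most_one) auto
  then have "metric_dim (block True m) \<le> m" using metric_dim_le by fastforce
  moreover obtain B where B: "resolves (block True m) B" "finite B"
      "card B = metric_dim (block True m)"
    by (rule metric_basis_ex)
  have "card {0..m} \<le> card B + card ((\<lambda>_. 0 :: nat) ` {0..m})"
    using B(1,2) by (rule card_le_of_twin_classes) (auto simp: graph_dist_block)
  then have "m \<le> metric_dim (block True m)" using B(3) by (simp add: image_constant_conv)
  ultimately show ?thesis by simp
qed

text \<open>The leaves form the single class 0. For \<open>m = 1\<close> the formula fails, because
  an edge has dimension 1.\<close>

lemma metric_dim_block_star:
  assumes "m \<ge> 2"
  shows "metric_dim (block False m) + 1 = m"
proof -
  have "metric_dim (block False m) + card ((\<lambda>_. 0 :: nat) ` {1..m}) = card {1..m}"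
  proof (rule metric_dim_of_twin_classes[where c = 0])
    show "\<exists>y \<in> {1..m}. \<exists>z \<in> {1..m}. y \<noteq> z \<and> (0 :: nat) = 0 \<and> \<not> ((0 :: nat) = 0 \<and> (0 :: nat) \<noteq> 0)"
      by (rule bexI[of _ 1], rule bexI[of _ 2]) (use assms in auto)
  qed (auto simp: graph_dist_block)
  then show ?thesis using assms by (simp add: image_constant_conv)
qed

text \<open>
  \<open>q\<close> stars rooted at their centres, then \<open>p\<close> complete graphs, then single edges.
\<close>

definition blocks :: "nat \<Rightarrow> nat \<Rightarrow> nat \<Rightarrow> nat \<Rightarrow> nat pair_pre_digraph" where
  "blocks q p N i = block (q < i) (if i \<le> q + p then N else 1)"

lemma rooted_family_blocks: "rooted_family n (blocks q p N) (\<lambda>_. 0)"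
  using pair_connected_graph_block
  by (auto simp: rooted_family_def rooted_graphs_def blocks_def pair_connected_graph_def
      pair_connected_graph_axioms_def)

context
  fixes n q p N :: nat
  assumes qp: "q + p \<le> n" and n: "n \<ge> 1" and N: "N \<ge> 2"
begin

interpretation rooted_family n "blocks q p N" "\<lambda>_. 0"
  by (rule rooted_family_blocks)

abbreviation "amalgam \<equiv> vertex_amal n (blocks q p N) (\<lambda>_. 0)"
abbreviation "emb0 \<equiv> amal_vertex (\<lambda>_. 0 :: nat)"

definition nonterminals :: "(nat \<times> nat) option set" where
  "nonterminals = Some ` (SIGMA i : {1..n}. {1..if i \<le> q + p then N else 1})"

text \<open>
  All leaves of the stars and of the single edges are twins of each other and form class 0.
\<close>

definition twin_class :: "(nat \<times> nat) option \<Rightarrow> nat" where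
  "twin_class x = (case x of None \<Rightarrow> 0 | Some (i, u) \<Rightarrow> if q < i \<and> i \<le> q + p then i else 0)"

lemma card_nonterminals: "card nonterminals = (q + p) * N + (n - (q + p))"
proof -
  have "{1..n} \<inter> {i. i \<le> q + p} = {1..q + p}" "{1..n} \<inter> - {i. i \<le> q + p} = {q + p + 1..n}"
    using qp by auto
  then have "(\<Sum>i = 1..n. if i \<le> q + p then N else 1) = (q + p) * N + (n - (q + p))"
    by (simp add: sum.If_cases)
  then show ?thesis unfolding nonterminals_def by (subst card_image) auto
qed

lemma verts_amal_blocks: "pverts amalgam = insert None nonterminals"
proof
  show "pverts amalgam \<subseteq> insert None nonterminals"
    by (auto simp: verts_amal nonterminals_def blocks_def amal_vertex_def)
  have "None \<in> pverts amalgam"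
    using emb_in_verts[of 1 0] n by (simp add: blocks_def)
  moreover have "Some (i, u) \<in> pverts amalgam" if "Some (i, u) \<in> nonterminals" for i u
    using emb_in_verts[of i u] that by (auto simp: nonterminals_def blocks_def amal_vertex_def)
  ultimately show "insert None nonterminals \<subseteq> pverts amalgam"
    by (auto simp: nonterminals_def)
qed

text \<open>In a complete graph or an edge the dimension equals the number of non-terminal vertices;
  in each of the \<open>q\<close> stars it is one less.\<close>

lemma sum_metric_dim_blocks: "card nonterminals = (\<Sum>i = 1..n. metric_dim (blocks q p N i)) + q"
proof -
  have "(\<Sum>i = 1..n. if i \<le> q + p then N else 1) =
      (\<Sum>i = 1..n. metric_dim (blocks q p N i) + (if i \<le> q then 1 else 0))"
    using metric_dim_block_star[OF N]
    by (intro sum.cong refl) (auto simp: blocks_def metric_dim_block_complete)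
  also have "\<dots> = (\<Sum>i = 1..n. metric_dim (blocks q p N i)) + (\<Sum>i = 1..n. if i \<le> q then 1 else 0)"
    by (rule sum.distrib)
  also have "(\<Sum>i = 1..n. if i \<le> q then 1 else 0) = q"
  proof -
    have "{1..n} \<inter> {i. i \<le> q} = {1..q}" using qp by auto
    then show ?thesis by (simp add: sum.If_cases)
  qed
  finally show ?thesis unfolding nonterminals_def by (subst card_image) auto
qed

text \<open>Class 0 is empty exactly when every component is one of the \<open>p\<close> complete
  graphs.\<close>

lemma card_twin_classes: "card (twin_class ` nonterminals) = p + (if p < n then 1 else 0)"
proof -
  have "twin_class ` nonterminals = {q + 1..q + p} \<union> (if p < n then {0} else {})" (is "_ = ?R")
  proof
    show "twin_class ` nonterminals \<subseteq> ?R"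
      using qp by (auto simp: nonterminals_def twin_class_def split: if_splits)
    have "i \<in> twin_class ` nonterminals" if "i \<in> {q + 1..q + p}" for i
      by (rule image_eqI[of _ _ "Some (i, 1)"])
        (use that qp N in \<open>auto simp: nonterminals_def twin_class_def\<close>)
    moreover have "0 \<in> twin_class ` nonterminals" if "p < n"
      \<comment> \<open>A leaf of the first star if there is one; otherwise \<open>p < n\<close>
        makes the last component a single edge.\<close>
      by (rule image_eqI[of _ _ "Some (if 1 \<le> q then 1 else n, 1)"])
        (use that qp N n in \<open>auto simp: nonterminals_def twin_class_def\<close>)
    ultimately show "?R \<subseteq> twin_class ` nonterminals" by auto
  qed
  then show ?thesis by auto
qed

text \<open>Subtract the number of twin classes from the number of non-terminal vertices. The
  hypothesis \<open>large\<close> supplies the pairs that separate each vertex from the common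
  one.\<close>

lemma metric_dim_amal_blocks:
  assumes large: "1 \<le> q \<or> 2 \<le> p \<or> (p = 1 \<and> 3 \<le> n)"
  shows "int (metric_dim amalgam) = (\<Sum>i = 1..n. int (metric_dim (blocks q p N i))) +
    (int q - int p - (if p < n then 1 else 0))"
proof -
  have dist: "graph_dist amalgam (emb0 i u) (emb0 j v) = (if i = j then graph_dist (blocks q p N j) u v
           else graph_dist (blocks q p N i) u 0 + graph_dist (blocks q p N j) 0 v)"
    if "i \<in> {1..n}" "j \<in> {1..n}" "u \<in> pverts (blocks q p N i)" "v \<in> pverts (blocks q p N j)" for i j u v
    using graph_dist_amal that by blast
  have mem: "Some (i, u) \<in> nonterminals \<longleftrightarrow>
      1 \<le> i \<and> i \<le> n \<and> 1 \<le> u \<and> u \<le> (if i \<le> q + p then N else 1)" for i u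
    by (auto simp: nonterminals_def)
  have nontermE: thesis
    if "x \<in> nonterminals" "\<And>i u. x = Some (i, u) \<Longrightarrow> 1 \<le> i \<Longrightarrow> i \<le> n \<Longrightarrow> 1 \<le> u \<Longrightarrow>
      u \<le> (if i \<le> q + p then N else 1) \<Longrightarrow> thesis" for x thesis
    using that by (auto simp: nonterminals_def)
  have "metric_dim amalgam + card (twin_class ` nonterminals) = card nonterminals"
  proof (rule metric_dim_of_twin_classes[where c = None])
    show "pverts amalgam = insert None nonterminals" by (rule verts_amal_blocks)
    show "None \<notin> nonterminals" "finite nonterminals" by (auto simp: nonterminals_def)
  next
    fix x assume "x \<in> nonterminals"
    then obtain i u where iu: "x = Some (i, u)" "1 \<le> i" "i \<le> n" "1 \<le> u"
        "u \<le> (if i \<le> q + p then N else 1)"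
      by (rule nontermE)
    then have x: "x = emb0 i u" and c: "None = emb0 i 0" by (auto simp: amal_vertex_def)
    show "graph_dist amalgam None x = 1" "graph_dist amalgam x None = 1"
      unfolding x c using iu by (subst dist; auto simp: blocks_def graph_dist_block)+
  next
    fix x y assume "x \<in> nonterminals" "y \<in> nonterminals"
    then obtain i u j v where xy: "x = Some (i, u)" "1 \<le> i" "i \<le> n" "1 \<le> u"
        "u \<le> (if i \<le> q + p then N else 1)"
        "y = Some (j, v)" "1 \<le> j" "j \<le> n" "1 \<le> v" "v \<le> (if j \<le> q + p then N else 1)"
      by (metis nontermE)
    then have "x = emb0 i u" "y = emb0 j v" by (auto simp: amal_vertex_def)
    then have "graph_dist amalgam x y = (if i = j then graph_dist (blocks q p N j) u v
           else graph_dist (blocks q p N i) u 0 + graph_dist (blocks q p N j) 0 v)"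
      using dist[of i j u v] xy by (simp add: blocks_def)
    \<comment> \<open>A single edge contributes only one non-terminal vertex, so class 0 contains no
      adjacent pair although edges are complete.\<close>
    then show "graph_dist amalgam x y = (if x = y then 0
        else if twin_class x = twin_class y \<and> twin_class x \<noteq> 0 then 1 else 2)"
      using xy by (auto simp: twin_class_def blocks_def graph_dist_block split: if_splits)
  next
    fix x assume x: "x \<in> nonterminals" "twin_class x \<noteq> 0"
    then obtain i u where iu: "x = Some (i, u)" "1 \<le> i" "i \<le> n" "i \<le> q + p" "1 \<le> u" "u \<le> N"
      by (auto elim!: nontermE simp: twin_class_def split: if_splits)
    show "\<exists>y \<in> nonterminals. y \<noteq> x \<and> twin_class y = twin_class x"
      by (rule bexI[of _ "Some (i, if u = 1 then 2 else 1)"])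
        (use iu N in \<open>auto simp: mem twin_class_def\<close>)
  next
    fix x assume x: "x \<in> nonterminals"
    obtain y z where "y \<in> nonterminals" "z \<in> nonterminals" "y \<noteq> z"
      "twin_class y = twin_class z" "\<not> (twin_class y = twin_class x \<and> twin_class x \<noteq> 0)"
    proof (cases "1 \<le> q \<or> 2 \<le> p")
      case True
      \<comment> \<open>If there is a star, component 1 is one and its leaves are in class 0.
        Otherwise components 1 and 2 are complete, and \<open>j\<close> is one whose class does not
        contain \<open>x\<close>.\<close>
      define j where "j = (if 1 \<le> q \<or> twin_class x \<noteq> 1 then 1 else 2 :: nat)"
      have j: "1 \<le> j" "j \<le> n" "j \<le> q + p" using True qp by (auto simp: j_def)
      show thesis
        by (rule that[of "Some (j, 1)" "Some (j, 2)"])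
          (use j N True in \<open>auto simp: mem twin_class_def j_def\<close>)
    next
      case False
      then have "p = 1" "q = 0" "3 \<le> n" using large by auto
      \<comment> \<open>With one complete graph and no star, components 2 and 3 are single edges,
        which provide two vertices of class 0.\<close>
      then have "Some (2, 1) \<in> nonterminals" "Some (3, 1) \<in> nonterminals"
        "twin_class (Some (2, 1)) = 0" "twin_class (Some (3, 1)) = 0"
        unfolding mem twin_class_def by auto
      then show thesis by (intro that[of "Some (2, 1)" "Some (3, 1)"]) auto
    qed
    then show "\<exists>y \<in> nonterminals. \<exists>z \<in> nonterminals. y \<noteq> z \<and> twin_class y = twin_class z \<and>
        \<not> (twin_class y = twin_class x \<and> twin_class x \<noteq> 0)"
      by blast
  qed
  then show ?thesis
    using card_twin_classes sum_metric_dim_blocks by (auto simp flip: of_nat_sum)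
qed

lemma card_verts_amal_blocks: "card (pverts amalgam) = (q + p) * N + (n - (q + p)) + 1"
  unfolding verts_amal_blocks card_nonterminals[symmetric]
  by (simp add: nonterminals_def card_insert_disjoint)

end

section \<open>Infinite families and attained values\<close>

lemma not_digraph_iso_if_card_verts_ne:
  assumes "card (pverts G) \<noteq> card (pverts H)"
  shows "\<not> digraph_iso (with_proj G) (with_proj H)"
proof
  assume "digraph_iso (with_proj G) (with_proj H)"
  then obtain f where "inj_on (iso_verts f) (pverts G)"
    "with_proj H = app_iso f (with_proj G)"
    by (auto simp: digraph_iso_def pre_digraph.digraph_isomorphism_def)
  moreover from this(2) have "pverts H = iso_verts f ` pverts G"
    by (metis verts_app_iso with_proj_simps(1))
  ultimately show False using assms by (simp add: card_image)
qed

text \<open>The offset \<open>k\<close> depends on \<open>n\<close>, \<open>q\<close> and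
  \<open>p\<close> only, so the size \<open>N\<close> is free to vary and yields amalgamations with
  different numbers of vertices.\<close>

lemma infinite_family_of_amalgamations:
  fixes n q p :: nat
  assumes n: "n \<ge> 1" and qp: "q + p \<le> n" and large: "1 \<le> q \<or> 2 \<le> p \<or> (p = 1 \<and> 3 \<le> n)"
    and k: "k = int q - int p - (if p < n then 1 else 0)"
  shows "\<exists>S :: ((nat \<Rightarrow> nat pair_pre_digraph) \<times> (nat \<Rightarrow> nat)) set. infinite S \<and>
    (\<forall>(G, t) \<in> S. rooted_graphs n G t \<and>
      int (metric_dim (vertex_amal n G t)) = (\<Sum>i = 1..n. int (metric_dim (G i))) + k) \<and>
    pairwise (\<lambda>(G, t) (G', t').
      \<not> digraph_iso (with_proj (vertex_amal n G t)) (with_proj (vertex_amal n G' t'))) S"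
proof -
  define F where "F = (\<lambda>N. (blocks q p N, \<lambda>_ :: nat. 0 :: nat))"
  define c where "c = (\<lambda>(G :: nat \<Rightarrow> nat pair_pre_digraph, t). card (pverts (vertex_amal n G t)))"
  have c: "c (F N) = (q + p) * N + (n - (q + p)) + 1" if "N \<ge> 2" for N
    using card_verts_amal_blocks[OF qp n that] by (simp add: c_def F_def)
  \<comment> \<open>\<open>large\<close> gives \<open>q + p > 0\<close>, so the number of vertices
    strictly increases with \<open>N\<close>.\<close>
  have inj: "inj_on (c \<circ> F) {2..}"
    using large by (intro inj_onI) (auto simp: c)
  have "infinite (F ` {2..})"
    using finite_imageD[OF _ inj_on_imageI2[OF inj]] infinite_Ici by blast
  moreover have "rooted_graphs n (blocks q p N) (\<lambda>_. 0)" for N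
    using rooted_family_blocks by (simp add: rooted_family_def)
  moreover have "int (metric_dim (vertex_amal n (blocks q p N) (\<lambda>_. 0))) =
      (\<Sum>i = 1..n. int (metric_dim (blocks q p N i))) + k" if "N \<ge> 2" for N
    unfolding k using qp n that large by (rule metric_dim_amal_blocks)
  moreover have "pairwise (\<lambda>(G, t) (G', t').
      \<not> digraph_iso (with_proj (vertex_amal n G t)) (with_proj (vertex_amal n G' t'))) (F ` {2..})"
  proof (rule pairwiseI)
    fix x y assume "x \<in> F ` {2..}" "y \<in> F ` {2..}" "x \<noteq> y"
    then have "c x \<noteq> c y" using inj by (auto simp: inj_on_def)
    then show "(case x of (G, t) \<Rightarrow> \<lambda>(G', t').
        \<not> digraph_iso (with_proj (vertex_amal n G t)) (with_proj (vertex_amal n G' t'))) y"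
      by (auto simp: c_def split: prod.splits intro: not_digraph_iso_if_card_verts_ne[THEN notE])
  qed
  ultimately show ?thesis by (intro exI[of _ "F ` {2..}"]) (auto simp: F_def)
qed

text \<open>For \<open>n = 1\<close> the amalgamation is a copy of the only component, so the offset
  is 0 and the lower bound is not attained; hence the condition \<open>n \<ge> 2\<close>
  there.\<close>

theorem theorem5:
  fixes n :: nat
  assumes "n \<ge> 1"
  shows
    "(\<forall>(G :: nat \<Rightarrow> 'a pair_pre_digraph) t. rooted_graphs n G t \<longrightarrow>
        (\<Sum>i = 1..n. int (metric_dim (G i))) - int n \<le> int (metric_dim (vertex_amal n G t)) \<and>
        int (metric_dim (vertex_amal n G t)) \<le> (\<Sum>i = 1..n. int (metric_dim (G i))) + int n - 1)
     \<and> (n \<ge> 2 \<longrightarrow> (\<exists>(G :: nat \<Rightarrow> nat pair_pre_digraph) t. rooted_graphs n G t \<and>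
          int (metric_dim (vertex_amal n G t)) = (\<Sum>i = 1..n. int (metric_dim (G i))) - int n))
     \<and> (\<exists>(G :: nat \<Rightarrow> nat pair_pre_digraph) t. rooted_graphs n G t \<and>
          int (metric_dim (vertex_amal n G t)) = (\<Sum>i = 1..n. int (metric_dim (G i))) + int n - 1)
     \<and> (\<forall>k \<in> {- int n..int n - 1}. (k = - int n \<longrightarrow> n \<ge> 2) \<longrightarrow>
          (\<exists>S :: ((nat \<Rightarrow> nat pair_pre_digraph) \<times> (nat \<Rightarrow> nat)) set. infinite S \<and>
             (\<forall>(G, t) \<in> S. rooted_graphs n G t \<and>
                int (metric_dim (vertex_amal n G t)) = (\<Sum>i = 1..n. int (metric_dim (G i))) + k) \<and>
             pairwise (\<lambda>(G, t) (G', t').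
                \<not> digraph_iso (with_proj (vertex_amal n G t)) (with_proj (vertex_amal n G' t'))) S))"
proof -
  have family: "\<exists>S :: ((nat \<Rightarrow> nat pair_pre_digraph) \<times> (nat \<Rightarrow> nat)) set. infinite S \<and>
    (\<forall>(G, t) \<in> S. rooted_graphs n G t \<and>
      int (metric_dim (vertex_amal n G t)) = (\<Sum>i = 1..n. int (metric_dim (G i))) + k) \<and>
    pairwise (\<lambda>(G, t) (G', t').
      \<not> digraph_iso (with_proj (vertex_amal n G t)) (with_proj (vertex_amal n G' t'))) S"
    if k: "- int n \<le> k" "k \<le> int n - 1" "k = - int n \<longrightarrow> n \<ge> 2" for k
  proof -
    \<comment> \<open>The offset is \<open>q - p - 1\<close> when \<open>p < n\<close>, and
      \<open>- n\<close> when \<open>p = n\<close>; the cases solve this for \<open>q\<close> and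
      \<open>p\<close>.\<close>
    consider "k = - int n" | "- int n < k" "k \<le> -2" | "- int n < k" "k = -1" | "k \<ge> 0"
      using k by linarith
    then show ?thesis
    proof cases
      case 1
      then show ?thesis
        using assms k by (intro infinite_family_of_amalgamations[where q = 0 and p = n]) auto
    next
      case 2
      then show ?thesis
        using assms by (intro infinite_family_of_amalgamations[where q = 0 and p = "nat (- k - 1)"]) auto
    next
      \<comment> \<open>\<open>q = p = 0\<close> would also solve the equation but leaves only
        single edges, whose size cannot vary; \<open>q = p = 1\<close> fits because
        \<open>-1 > - n\<close> gives \<open>n \<ge> 2\<close>.\<close>
      case 3
      then show ?thesis
        using assms by (intro infinite_family_of_amalgamations[where q = 1 and p = 1]) auto
    next
      case 4
      then show ?thesis
        using assms k by (intro infinite_family_of_amalgamations[where q = "nat (k + 1)" and p = 0]) auto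
    qed
  qed
  have attained: "\<exists>(G :: nat \<Rightarrow> nat pair_pre_digraph) t. rooted_graphs n G t \<and>
      int (metric_dim (vertex_amal n G t)) = (\<Sum>i = 1..n. int (metric_dim (G i))) + k"
    if k: "- int n \<le> k" "k \<le> int n - 1" "k = - int n \<longrightarrow> n \<ge> 2" for k
  proof -
    obtain S :: "((nat \<Rightarrow> nat pair_pre_digraph) \<times> (nat \<Rightarrow> nat)) set"
      where S: "infinite S" "\<forall>(G, t) \<in> S. rooted_graphs n G t \<and>
        int (metric_dim (vertex_amal n G t)) = (\<Sum>i = 1..n. int (metric_dim (G i))) + k"
      using family[OF k] by blast
    then obtain G t where "(G, t) \<in> S" by (metis finite.emptyI all_not_in_conv surj_pair)
    then show ?thesis using S(2) by blast
  qed
  have bounds: "(\<Sum>i = 1..n. int (metric_dim (G i))) - int n \<le> int (metric_dim (vertex_amal n G t)) \<and>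
      int (metric_dim (vertex_amal n G t)) \<le> (\<Sum>i = 1..n. int (metric_dim (G i))) + int n - 1"
    if "rooted_graphs n G t" for G :: "nat \<Rightarrow> 'a pair_pre_digraph" and t
  proof -
    interpret rooted_family n G t using that by unfold_locales
    show ?thesis using metric_dim_amal_ge metric_dim_amal_le[OF assms]
      by (simp flip: of_nat_sum)
  qed
  show ?thesis
  proof (intro conjI impI allI ballI)
    assume "n \<ge> 2"
    then show "\<exists>(G :: nat \<Rightarrow> nat pair_pre_digraph) t. rooted_graphs n G t \<and>
        int (metric_dim (vertex_amal n G t)) = (\<Sum>i = 1..n. int (metric_dim (G i))) - int n"
      using attained[of "- int n"] by simp
  next
    show "\<exists>(G :: nat \<Rightarrow> nat pair_pre_digraph) t. rooted_graphs n G t \<and>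
        int (metric_dim (vertex_amal n G t)) = (\<Sum>i = 1..n. int (metric_dim (G i))) + int n - 1"
      using attained[of "int n - 1"] assms by (simp add: algebra_simps)
  qed (use bounds family in auto)
qed

end
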